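(* Let $d: E_d\to[0,\infty)$ be a floppy graph metric with vertex set $V_d$, let $x,y\in V_d$ be distinct points with $\{x,y\}\notin E_d$, and let $r$ be a real number with $\frac13\check d(x,y)+\frac23\hat d(x,y)\le r<\hat d(x,y)$. Then the function $D=d\cup\{\langle \{x,y\},r\rangle\}$ (defined on $E_d\cup\{\{x,y\}\}$, equal to $d$ on $E_d$ and to $r$ at $\{x,y\}$) is a floppy graph metric.
   Context: For a set $X$, $[X]^2=\{A\subseteq X:|A|=2\}$; we write $xy$ for $\{x,y\}$. A graph is a set $E$ of 2-element sets; its vertex set is $V=\bigcup E$; it is connected if any two vertices $x,y$ are joined by a sequence $x=x_0,\dots,x_n=y$ with $x_{i-1}x_i\in E$ for $0<i\le n$. For a function $d:E_d\to[0,\infty)$ on a connected graph $E_d$ with vertex set $V_d$, the shortest-path pseudometric is $\hat d(x,y)=\inf\{\sum_{i=1}^n d(x_{i-1}x_i): x_0=x,\ x_n=y,\ x_{i-1}x_i\in E_d \text{ for } 0<i\le n\}$ (with $\hat d(x,x)=0$), and $\check d(x,y)=\sup_{ab\in E_d}\max\{0,d(ab)-\hat d(a,x)-\hat d(y,b)\}$ (the supremum over unordered edges, so both labelings of $ab$ are used). A graph pseudometric is a function $d:E_d\to[0,\infty)$ on a connected graph $E_d$ such that $d(x_0x_n)\le\sum_{i=1}^n d(x_{i-1}x_i)$ whenever $x_0x_n$ and all $x_{i-1}x_i$ lie in $E_d$ (equivalently $d(xy)=\hat d(x,y)$ for all $xy\in E_d$). It is a graph metric if moreover $d(xy)>0$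 for all $xy\in E_d$. A graph pseudometric $d$ is floppy if $\check d(x,y)<\hat d(x,y)$ for all $x,y\in V_d$ with $xy\in[V_d]^2\setminus E_d$. *)

theory Defs
  imports "HOL-Analysis.Analysis"
begin

text \<open>
  A function on a graph \<open>E\<close> is given by the set \<open>E\<close> of its edges together with a total
  function \<open>d\<close> on sets; only the values of \<open>d\<close> on \<open>E\<close> matter.
\<close>

definition is_graph :: "'a set set \<Rightarrow> bool" where
  "is_graph E \<longleftrightarrow> (\<forall>e\<in>E. card e = 2)"

definition vertices :: "'a set set \<Rightarrow> 'a set" where
  "vertices E = \<Union>E"

text \<open>
  The walk of length \<open>n\<close> is \<open>p 0, \<dots>, p n\<close>, and \<open>n = 0\<close> is allowed. In particular the
  one-vertex walk contributes the empty sum \<open>0\<close> to \<open>d_hat E d x x\<close>.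
\<close>

definition is_walk :: "'a set set \<Rightarrow> 'a \<Rightarrow> 'a \<Rightarrow> nat \<Rightarrow> (nat \<Rightarrow> 'a) \<Rightarrow> bool" where
  "is_walk E x y n p \<longleftrightarrow> p 0 = x \<and> p n = y \<and> (\<forall>i\<in>{1..n}. {p (i - 1), p i} \<in> E)"

definition walk_length :: "('a set \<Rightarrow> real) \<Rightarrow> nat \<Rightarrow> (nat \<Rightarrow> 'a) \<Rightarrow> real" where
  "walk_length d n p = (\<Sum>i = 1..n. d {p (i - 1), p i})"

definition connected_graph :: "'a set set \<Rightarrow> bool" where
  "connected_graph E \<longleftrightarrow>
     is_graph E \<and> (\<forall>x\<in>vertices E. \<forall>y\<in>vertices E. \<exists>n p. is_walk E x y n p)"

text \<open>
  The infimum and the supremum are taken in the reals. On a connected graph with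
  \<open>d \<ge> 0\<close>, and for vertices \<open>x\<close>, \<open>y\<close>, the set of lengths is nonempty and bounded below by
  \<open>0\<close>. If \<open>d\<close> is moreover a graph pseudometric, the terms of the supremum are bounded
  above by \<open>d_hat E d x y\<close>, and there is at least one of them as soon as there is a vertex.
  The supremum ranges over ordered pairs, hence over both labelings of every edge.
\<close>

definition d_hat :: "'a set set \<Rightarrow> ('a set \<Rightarrow> real) \<Rightarrow> 'a \<Rightarrow> 'a \<Rightarrow> real" where
  "d_hat E d x y = Inf {walk_length d n p | n p. is_walk E x y n p}"

definition d_check :: "'a set set \<Rightarrow> ('a set \<Rightarrow> real) \<Rightarrow> 'a \<Rightarrow> 'a \<Rightarrow> real" where
  "d_check E d x y =
     Sup {max 0 (d {a, b} - d_hat E d a x - d_hat E d y b) | a b. {a, b} \<in> E}"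

definition graph_pseudometric :: "'a set set \<Rightarrow> ('a set \<Rightarrow> real) \<Rightarrow> bool" where
  "graph_pseudometric E d \<longleftrightarrow>
     connected_graph E \<and>
     (\<forall>e\<in>E. 0 \<le> d e) \<and>
     (\<forall>x y n p. {x, y} \<in> E \<longrightarrow> is_walk E x y n p \<longrightarrow> d {x, y} \<le> walk_length d n p)"

definition graph_metric :: "'a set set \<Rightarrow> ('a set \<Rightarrow> real) \<Rightarrow> bool" where
  "graph_metric E d \<longleftrightarrow> graph_pseudometric E d \<and> (\<forall>e\<in>E. 0 < d e)"

definition floppy :: "'a set set \<Rightarrow> ('a set \<Rightarrow> real) \<Rightarrow> bool" where
  "floppy E d \<longleftrightarrow>
     graph_pseudometric E d \<and>
     (\<forall>x\<in>vertices E. \<forall>y\<in>vertices E.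
        x \<noteq> y \<longrightarrow> {x, y} \<notin> E \<longrightarrow> d_check E d x y < d_hat E d x y)"

end

theory Submission
  imports Defs
begin

text \<open>
  Write \<open>h\<close>, \<open>c\<close> for \<open>d_hat\<close>, \<open>d_check\<close> of \<open>d\<close> and \<open>H\<close> for \<open>d_hat\<close> of the extension. A walk in the
  extended graph can be assumed to cross the new edge at most once, so \<open>H u v\<close> is at least one of
  \<open>h u v\<close>, \<open>h u x + r + h y v\<close>, \<open>h u y + r + h x v\<close>. Consequently the new \<open>d_check\<close> at \<open>(u, v)\<close> is
  at most a maximum of finitely many numbers built from \<open>h\<close>, \<open>c\<close> and \<open>r\<close>. Since \<open>c\<close> is
  1-Lipschitz with respect to \<open>h\<close> in each argument, \<open>c \<le> h\<close>, and \<open>c x y < r < h x y\<close>, each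
  of these numbers is strictly smaller than \<open>H u v\<close>. The positivity of \<open>h\<close> off the diagonal enters
  only through the contribution \<open>r - h x u - h v y\<close> of the new edge itself.
\<close>

section \<open>Walks and their lengths\<close>

lemma is_walk_0: "is_walk E u v 0 p \<longleftrightarrow> p 0 = u \<and> v = u"
  by (auto simp: is_walk_def)

lemma is_walk_Suc:
  "is_walk E u v (Suc n) p \<longleftrightarrow> is_walk E u (p n) n p \<and> {p n, v} \<in> E \<and> p (Suc n) = v"
  by (auto simp: is_walk_def atLeastAtMostSuc_conv)

lemma walk_length_0: "walk_length d 0 p = 0"
  by (simp add: walk_length_def)

lemma walk_length_Suc: "walk_length d (Suc n) p = walk_length d n p + d {p n, p (Suc n)}"
  by (simp add: walk_length_def)

lemma is_walk_upd_Suc: "is_walk E u v n p \<Longrightarrow> {v, w} \<in> E \<Longrightarrow> is_walk E u w (Suc n) (p(Suc n := w))"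
  by (auto simp: is_walk_def atLeastAtMostSuc_conv)

lemma walk_length_upd_Suc:
  assumes "is_walk E u v n p"
  shows "walk_length d (Suc n) (p(Suc n := w)) = walk_length d n p + d {v, w}"
  using assms by (auto simp: walk_length_def is_walk_def intro!: sum.cong)

lemma verticesI: assumes "{a, b} \<in> E" shows "a \<in> vertices E" "b \<in> vertices E"
  using assms by (auto simp: vertices_def)

lemma is_walk_vertices: "is_walk E u v n p \<Longrightarrow> u \<in> vertices E \<Longrightarrow> v \<in> vertices E"
  by (cases n) (auto simp: is_walk_0 is_walk_Suc dest: verticesI)

lemma is_walk_mono: "is_walk E u v n p \<Longrightarrow> E \<subseteq> F \<Longrightarrow> is_walk F u v n p"
  by (auto simp: is_walk_def)

lemma is_graph_edgeE:
  assumes "is_graph E" "e \<in> E"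
  obtains a b where "e = {a, b}" "a \<noteq> b"
  using assms unfolding is_graph_def card_2_iff by blast

text \<open>Connectedness makes the set of lengths nonempty, without which the real infimum says
  nothing.\<close>

lemma le_d_hat:
  assumes "connected_graph E" "u \<in> vertices E" "v \<in> vertices E"
    and "\<And>n p. is_walk E u v n p \<Longrightarrow> B \<le> walk_length d n p"
  shows "B \<le> d_hat E d u v"
  unfolding d_hat_def using assms by (intro cInf_greatest) (auto simp: connected_graph_def)

lemma walk_length_nonneg:
  assumes "\<And>e. e \<in> E \<Longrightarrow> 0 \<le> d e" "is_walk E u v n p"
  shows "0 \<le> walk_length d n p"
  using assms by (auto simp: walk_length_def is_walk_def intro!: sum_nonneg)

section \<open>\<open>d_hat\<close> as a pseudometric extending the edge weights\<close>

context
  fixes E :: "'a set set" and d :: "'a set \<Rightarrow> real"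
  assumes pm: "graph_pseudometric E d"
begin

lemma connected: "connected_graph E" and weight_nonneg: "e \<in> E \<Longrightarrow> 0 \<le> d e"
  using pm by (auto simp: graph_pseudometric_def)

lemma d_hat_le: "is_walk E u v n p \<Longrightarrow> d_hat E d u v \<le> walk_length d n p"
  unfolding d_hat_def
  by (intro cInf_lower bdd_belowI[of _ 0]) (auto intro: walk_length_nonneg weight_nonneg)

lemma d_hat_nonneg: "u \<in> vertices E \<Longrightarrow> v \<in> vertices E \<Longrightarrow> 0 \<le> d_hat E d u v"
  by (intro le_d_hat connected walk_length_nonneg weight_nonneg)

lemma d_hat_refl: "u \<in> vertices E \<Longrightarrow> d_hat E d u u = 0"
  using d_hat_le[of u u 0 "\<lambda>_. u"] d_hat_nonneg[of u u] by (simp add: is_walk_0 walk_length_0)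

text \<open>Appending the edge to any walk from \<open>u\<close> to \<open>v\<close> gives a walk to
  \<open>w\<close>; the infimum is then taken over the shorter walks.\<close>

lemma d_hat_step:
  assumes "u \<in> vertices E" "{v, w} \<in> E"
  shows "d_hat E d u w \<le> d_hat E d u v + d {v, w}"
proof -
  have "d_hat E d u w - d {v, w} \<le> d_hat E d u v"
  proof (intro le_d_hat connected)
    fix n p assume p: "is_walk E u v n p"
    show "d_hat E d u w - d {v, w} \<le> walk_length d n p"
      using d_hat_le[OF is_walk_upd_Suc[OF p assms(2)]] walk_length_upd_Suc[OF p, of d w] by simp
  qed (use assms verticesI in auto)
  then show ?thesis by simp
qed

text \<open>No walks are concatenated: \<open>d_hat_step\<close> is iterated along a walk from
  \<open>v\<close> to \<open>w\<close>, and the infimum over such walks follows.\<close>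

lemma d_hat_triangle:
  assumes "u \<in> vertices E" "v \<in> vertices E" "w \<in> vertices E"
  shows "d_hat E d u w \<le> d_hat E d u v + d_hat E d v w"
proof -
  have "d_hat E d u w - d_hat E d u v \<le> walk_length d n p" if "is_walk E v w n p" for w n p
    using that
  proof (induction n arbitrary: w)
    case (Suc n)
    then show ?case
      using d_hat_step[OF assms(1), of "p n" w] by (force simp: is_walk_Suc walk_length_Suc)
  qed (simp add: is_walk_0 walk_length_0)
  then have "d_hat E d u w - d_hat E d u v \<le> d_hat E d v w"
    using assms by (intro le_d_hat connected)
  then show ?thesis by simp
qed

lemma d_hat_edge:
  assumes "{a, b} \<in> E"
  shows "d_hat E d a b = d {a, b}"
proof (rule antisym)
  show "d_hat E d a b \<le> d {a, b}"
    using d_hat_step[OF _ assms, of a] d_hat_refl[of a] verticesI[OF assms] by simp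
  show "d {a, b} \<le> d_hat E d a b"
    using pm assms verticesI[OF assms]
    by (intro le_d_hat connected) (auto simp: graph_pseudometric_def)
qed

text \<open>One inequality suffices. It avoids reversing walks: each further edge costs the same in
  both directions by \<open>d_hat_edge\<close>, and the triangle inequality adds it at the
  front.\<close>

lemma d_hat_commute:
  assumes "u \<in> vertices E" "v \<in> vertices E"
  shows "d_hat E d u v = d_hat E d v u"
proof -
  have "d_hat E d v u \<le> d_hat E d u v" if V: "u \<in> vertices E" "v \<in> vertices E" for u v
  proof (intro le_d_hat connected V)
    show "d_hat E d v u \<le> walk_length d n p" if "is_walk E u v n p" for n p
      using that
    proof (induction n arbitrary: v)
      case 0
      then show ?case using d_hat_refl V by (simp add: is_walk_0 walk_length_0)
    next
      case (Suc n)
      then have e: "{v, p n} \<in> E" and "d_hat E d (p n) u \<le> walk_length d n p" and "p (Suc n) = v"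
        by (auto simp: is_walk_Suc insert_commute)
      then show ?case
        using d_hat_triangle[of v "p n" u] d_hat_edge[OF e] verticesI[OF e] V
        by (simp add: walk_length_Suc insert_commute)
    qed
  qed
  then show ?thesis using assms by (simp add: antisym)
qed

section \<open>The lower distance \<open>d_check\<close>\<close>

lemma edge_le_d_hat:
  assumes "{a, b} \<in> E" "u \<in> vertices E" "v \<in> vertices E"
  shows "d {a, b} \<le> d_hat E d a u + d_hat E d u v + d_hat E d v b"
  using d_hat_triangle[of a u b] d_hat_triangle[of u v b] d_hat_edge[OF assms(1)]
    verticesI[OF assms(1)] assms by simp

text \<open>The terms of the supremum are bounded by \<open>d_hat E d u v\<close>, so the real
  supremum is an upper bound.\<close>

lemma edge_diff_le_d_check:
  assumes "{a, b} \<in> E" "u \<in> vertices E" "v \<in> vertices E"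
  shows "max 0 (d {a, b} - d_hat E d a u - d_hat E d v b) \<le> d_check E d u v"
  unfolding d_check_def
proof (rule cSup_upper)
  show "bdd_above {max 0 (d {a, b} - d_hat E d a u - d_hat E d v b) |a b. {a, b} \<in> E}"
    using edge_le_d_hat[OF _ assms(2,3)] d_hat_nonneg[OF assms(2,3)]
    by (intro bdd_aboveI[of _ "d_hat E d u v"]) (fastforce simp: algebra_simps)
qed (use assms in auto)

lemma d_check_nonneg:
  assumes "u \<in> vertices E" "v \<in> vertices E"
  shows "0 \<le> d_check E d u v"
proof -
  obtain e where "e \<in> E" using assms by (auto simp: vertices_def)
  moreover obtain a b where "e = {a, b}"
    using is_graph_edgeE connected \<open>e \<in> E\<close> unfolding connected_graph_def by metis
  ultimately show ?thesis using edge_diff_le_d_check[of a b u v] assms by simp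
qed

end

text \<open>The condition \<open>0 \<le> B\<close> takes care of the truncation
  \<open>max 0\<close>, and an edge makes the set of terms nonempty.\<close>

lemma d_check_le:
  assumes "is_graph E" "E \<noteq> {}" "0 \<le> B"
    and "\<And>a b. {a, b} \<in> E \<Longrightarrow> d {a, b} - d_hat E d a u - d_hat E d v b \<le> B"
  shows "d_check E d u v \<le> B"
  unfolding d_check_def
proof (rule cSup_least)
  obtain e where "e \<in> E" using assms(2) by blast
  then obtain a b where "{a, b} \<in> E"
    using is_graph_edgeE[OF assms(1)] by metis
  then show "{max 0 (d {a, b} - d_hat E d a u - d_hat E d v b) |a b. {a, b} \<in> E} \<noteq> {}"
    by blast
qed (use assms in auto)

context
  fixes E :: "'a set set" and d :: "'a set \<Rightarrow> real"
  assumes pm: "graph_pseudometric E d"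
begin

lemma d_check_le_pseudometric:
  assumes "u \<in> vertices E" "0 \<le> B"
    and "\<And>a b. {a, b} \<in> E \<Longrightarrow> d {a, b} - d_hat E d a u - d_hat E d v b \<le> B"
  shows "d_check E d u v \<le> B"
  using assms connected[OF pm]
  by (intro d_check_le) (auto simp: connected_graph_def vertices_def)

lemma d_check_le_d_hat:
  assumes "u \<in> vertices E" "v \<in> vertices E"
  shows "d_check E d u v \<le> d_hat E d u v"
  using edge_le_d_hat[OF pm _ assms] d_hat_nonneg[OF pm assms] assms
  by (intro d_check_le_pseudometric) (auto simp: algebra_simps)

text \<open>By the triangle inequality, replacing \<open>u\<close>, \<open>v\<close> by
  \<open>u'\<close>, \<open>v'\<close> changes the term of each edge by at most the two
  displacements.\<close>

lemma d_check_lipschitz: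
  assumes V: "u \<in> vertices E" "v \<in> vertices E" "u' \<in> vertices E" "v' \<in> vertices E"
  shows "d_check E d u v \<le> d_check E d u' v' + d_hat E d u u' + d_hat E d v v'"
proof (intro d_check_le_pseudometric V)
  show "0 \<le> d_check E d u' v' + d_hat E d u u' + d_hat E d v v'"
    using V pm by (intro add_nonneg_nonneg d_check_nonneg d_hat_nonneg) auto
  show "d {a, b} - d_hat E d a u - d_hat E d v b
      \<le> d_check E d u' v' + d_hat E d u u' + d_hat E d v v'" if "{a, b} \<in> E" for a b
    using edge_diff_le_d_check[OF pm that V(3,4)] d_hat_triangle[OF pm _ V(1,3), of a]
      d_hat_triangle[OF pm V(4,2), of b] d_hat_commute[OF pm V(2,4)] verticesI[OF that] by simp
qed

text \<open>Exchanging \<open>u\<close> and \<open>v\<close> amounts to exchanging the two labelings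
  of each edge.\<close>

lemma d_check_commute:
  assumes "u \<in> vertices E" "v \<in> vertices E"
  shows "d_check E d u v = d_check E d v u"
proof -
  have "d_check E d u v \<le> d_check E d v u" if V: "u \<in> vertices E" "v \<in> vertices E" for u v
  proof (intro d_check_le_pseudometric V)
    show "0 \<le> d_check E d v u" using V by (intro d_check_nonneg pm)
    show "d {a, b} - d_hat E d a u - d_hat E d v b \<le> d_check E d v u" if "{a, b} \<in> E" for a b
      using edge_diff_le_d_check[OF pm _ V(2,1), of b a] that verticesI[OF that] V
        d_hat_commute[OF pm, of u a] d_hat_commute[OF pm, of b v]
      by (simp add: insert_commute)
  qed
  then show ?thesis using assms by (simp add: antisym)
qed

section \<open>Walks through an added edge\<close>

text \<open>Induction on the walk, removing its last edge. An old edge preserves each alternative.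
  If the last edge is the new one, a walk that had crossed it in the same direction keeps its
  alternative, and one that had crossed it in the opposite direction falls back to the first
  alternative.\<close>

lemma d_hat_insert_ge:
  assumes V: "x \<in> vertices E" "y \<in> vertices E" "u \<in> vertices E" "v \<in> vertices E"
    and "0 \<le> r"
    and walk: "is_walk (insert {x, y} E) u v n p"
  shows "d_hat E d u v \<le> walk_length (d({x, y} := r)) n p \<or>
     d_hat E d u x + r + d_hat E d y v \<le> walk_length (d({x, y} := r)) n p \<or>
     d_hat E d u y + r + d_hat E d x v \<le> walk_length (d({x, y} := r)) n p"
  using walk V(4)
proof (induction n arbitrary: v)
  case 0
  then show ?case by (simp add: is_walk_0 walk_length_0 d_hat_refl[OF pm V(3)])
next
  case (Suc n)
  let ?D = "d({x, y} := r)" and ?w = "p n"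
  have pv: "p (Suc n) = v" and e: "{?w, v} \<in> insert {x, y} E"
    and walk: "is_walk (insert {x, y} E) u ?w n p"
    using Suc.prems(1) by (auto simp: is_walk_Suc)
  have w: "?w \<in> vertices E"
    using e V by (auto simp: doubleton_eq_iff dest: verticesI)
  note IH = Suc.IH[OF walk w]
  have len: "walk_length ?D (Suc n) p = walk_length ?D n p + ?D {?w, v}"
    by (simp add: walk_length_Suc pv)
  consider "?w = x" "v = y" | "?w = y" "v = x" | "{?w, v} \<in> E" "{?w, v} \<noteq> {x, y}"
    using e by (auto simp: doubleton_eq_iff)
  then show ?case
  proof cases
    case 1
    then have "walk_length ?D (Suc n) p = walk_length ?D n p + r"
      using len by (simp add: insert_commute)
    then show ?thesis
      using IH[unfolded 1] d_hat_refl[OF pm V(1)] d_hat_refl[OF pm V(2)]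
        d_hat_nonneg[OF pm V(2,1)] \<open>0 \<le> r\<close>
      unfolding 1 by linarith
  next
    case 2
    then have "walk_length ?D (Suc n) p = walk_length ?D n p + r"
      using len by (simp add: insert_commute)
    then show ?thesis
      using IH[unfolded 2] d_hat_refl[OF pm V(1)] d_hat_refl[OF pm V(2)]
        d_hat_nonneg[OF pm V(1,2)] \<open>0 \<le> r\<close>
      unfolding 2 by linarith
  next
    case 3
    then have "walk_length ?D (Suc n) p = walk_length ?D n p + d {?w, v}"
      using len by simp
    then show ?thesis
      using IH d_hat_step[OF pm V(3) 3(1)] d_hat_step[OF pm V(1) 3(1)]
        d_hat_step[OF pm V(2) 3(1)] by linarith
  qed
qed

end

lemma vertices_insert:
  "x \<in> vertices E \<Longrightarrow> y \<in> vertices E \<Longrightarrow> vertices (insert {x, y} E) = vertices E"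
  by (auto simp: vertices_def)

text \<open>Edges have positive weight, and for a non-edge floppiness puts \<open>d_hat\<close>
  strictly above \<open>d_check\<close>, which is nonnegative.\<close>

lemma floppy_d_hat_pos:
  assumes "graph_metric E d" "floppy E d" "u \<in> vertices E" "v \<in> vertices E" "u \<noteq> v"
  shows "0 < d_hat E d u v"
proof -
  have pm: "graph_pseudometric E d" using assms(1) by (simp add: graph_metric_def)
  show ?thesis
  proof (cases "{u, v} \<in> E")
    case True
    then show ?thesis using assms(1) d_hat_edge[OF pm True] by (simp add: graph_metric_def)
  next
    case False
    then have "d_check E d u v < d_hat E d u v" using assms by (simp add: floppy_def)
    then show ?thesis using d_check_nonneg[OF pm assms(3,4)] by linarith
  qed
qed

section \<open>The extension by the edge \<open>{x, y}\<close> of weight \<open>r\<close>\<close>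

context
  fixes E :: "'a set set" and d :: "'a set \<Rightarrow> real" and x y :: 'a and r :: real
  assumes gm: "graph_metric E d" and fl: "floppy E d"
    and x: "x \<in> vertices E" and y: "y \<in> vertices E" and xy: "x \<noteq> y" "{x, y} \<notin> E"
    and check_r: "d_check E d x y < r" and r_hat: "r < d_hat E d x y"
begin

private abbreviation (input) "F \<equiv> insert {x, y} E"
private abbreviation (input) "D \<equiv> d({x, y} := r)"
private abbreviation (input) "V \<equiv> vertices E"
private abbreviation (input) "h \<equiv> d_hat E d"
private abbreviation (input) "c \<equiv> d_check E d"
private abbreviation (input) "H \<equiv> d_hat F D"

lemma pseudometric: "graph_pseudometric E d"
  using gm by (simp add: graph_metric_def)

lemma r_pos: "0 < r"
  using d_check_nonneg[OF pseudometric x y] check_r by linarith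

lemma check_r': "c y x < r"
  using d_check_commute[OF pseudometric x y] check_r by simp

lemma connected_insert: "connected_graph F"
  using connected[OF pseudometric] xy(1) vertices_insert[OF x y] is_walk_mono[of E _ _ _ _ F]
  unfolding connected_graph_def is_graph_def by (simp add: subset_insertI) blast

text \<open>The new edge is not undercut, since \<open>r < h x y\<close> and any walk crossing it
  costs at least \<open>r\<close>. For an old edge,
  \<open>d {a, b} - h a x - h y b \<le> c x y < r\<close> excludes a cheaper route across the new
  edge; \<open>c y x\<close> serves the other direction.\<close>

lemma graph_metric_insert: "graph_metric F D"
  unfolding graph_metric_def graph_pseudometric_def
proof (intro conjI connected_insert allI impI)
  show pos: "\<forall>e\<in>F. 0 < D e" and "\<forall>e\<in>F. 0 \<le> D e"
    using gm r_pos by (auto simp: graph_metric_def less_imp_le)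
  fix a b n p
  assume ab: "{a, b} \<in> F" and walk: "is_walk F a b n p"
  have V: "a \<in> V" "b \<in> V" using ab verticesI[of a b F] vertices_insert[OF x y] by auto
  have ge: "h a b \<le> walk_length D n p \<or> h a x + r + h y b \<le> walk_length D n p
      \<or> h a y + r + h x b \<le> walk_length D n p"
    using d_hat_insert_ge[OF pseudometric x y V _ walk] r_pos by simp
  show "D {a, b} \<le> walk_length D n p"
  proof (cases "{a, b} = {x, y}")
    case True
    then have "r < h a b"
      using r_hat d_hat_commute[OF pseudometric x y] by (auto simp: doubleton_eq_iff)
    moreover have "D {a, b} = r" using True by simp
    ultimately show ?thesis
      using ge d_hat_nonneg[OF pseudometric V(1) x] d_hat_nonneg[OF pseudometric V(1) y]
        d_hat_nonneg[OF pseudometric x V(2)] d_hat_nonneg[OF pseudometric y V(2)] by linarith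
  next
    case False
    then have e: "{a, b} \<in> E" using ab by simp
    have "D {a, b} = d {a, b}" using False by simp
    then show ?thesis
      using ge d_hat_edge[OF pseudometric e] edge_diff_le_d_check[OF pseudometric e x y]
        edge_diff_le_d_check[OF pseudometric e y x] check_r check_r' by linarith
  qed
qed

lemma d_hat_insert_cases:
  assumes V: "u \<in> V" "v \<in> V"
  shows "h u v \<le> H u v \<or> h u x + r + h y v \<le> H u v \<or> h u y + r + h x v \<le> H u v"
proof -
  \<comment> \<open>Which alternative holds may depend on the walk; their minimum is a uniform lower
    bound and so passes to the infimum.\<close>
  have "min (h u v) (min (h u x + r + h y v) (h u y + r + h x v)) \<le> H u v"
    using d_hat_insert_ge[OF pseudometric x y V] r_pos V vertices_insert[OF x y]
    by (intro le_d_hat connected_insert) (auto simp: min_le_iff_disj)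
  then show ?thesis by (simp add: min_le_iff_disj)
qed

lemma d_check_less_d_hat_insert:
  assumes u: "u \<in> V" and v: "v \<in> V" and uv: "u \<noteq> v" "{u, v} \<notin> F"
  shows "d_check F D u v < H u v"
proof -
  note pm = pseudometric
  note tri = d_hat_triangle[OF pm] and comm = d_hat_commute[OF pm]
  note nn = d_hat_nonneg[OF pm] and lip = d_check_lipschitz[OF pm] and ch = d_check_le_d_hat[OF pm]
  \<comment> \<open>\<open>c u v\<close> bounds the old edges when neither route crosses the new
    edge. The next four bound them when exactly one of the routes \<open>a\<close> to
    \<open>u\<close>, \<open>v\<close> to \<open>b\<close> crosses it, in either direction. The last
    two come from the new edge in its two labelings, and \<open>0\<close> absorbs the rest.\<close>
  define B where "B = Max {0, c u v, c x v - r - h y u, c y v - r - h x u, c u x - r - h y v,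
    c u y - r - h x v, r - h x u - h y v, r - h y u - h x v}"
  have B: "0 \<le> B" "c u v \<le> B" "c x v - r - h y u \<le> B" "c y v - r - h x u \<le> B"
    "c u x - r - h y v \<le> B" "c u y - r - h x v \<le> B" "r - h x u - h y v \<le> B"
    "r - h y u - h x v \<le> B"
    unfolding B_def by (rule Max_ge; simp)+
  have nonneg: "0 \<le> h u v" "0 \<le> h x u" "0 \<le> h x v" "0 \<le> h y u" "0 \<le> h y v"
    using nn u v x y by auto
  have sym: "h u x = h x u" "h u y = h y u" "h v x = h x v" "h v y = h y v" "h v u = h u v"
      "h y x = h x y"
    using comm u v x y by auto
  have "d_check F D u v \<le> B"
  proof (rule d_check_le)
    show "is_graph F" using connected_insert by (simp add: connected_graph_def)
    fix a b assume ab: "{a, b} \<in> F"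
    have V: "a \<in> V" "b \<in> V" using ab verticesI[of a b F] vertices_insert[OF x y] by auto
    note H = d_hat_insert_cases[OF V(1) u] d_hat_insert_cases[OF v V(2)]
    have pos: "0 \<le> h a u" "0 \<le> h v b" "0 \<le> h a x" "0 \<le> h a y" "0 \<le> h x b" "0 \<le> h y b"
      using nn u v x y V by auto
    show "D {a, b} - H a u - H v b \<le> B"
    proof (cases "{a, b} = {x, y}")
      case True
      \<comment> \<open>If either route crosses the new edge, it costs at least \<open>r\<close> and
        the difference is at most \<open>0\<close>.\<close>
      then have D: "D {a, b} = r" by simp
      consider "a = x" "b = y" | "a = y" "b = x"
        using True by (auto simp: doubleton_eq_iff)
      then show ?thesis
      proof cases
        case 1
        show ?thesis
          using H[unfolded 1] pos[unfolded 1] B nonneg sym r_pos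
          unfolding D unfolding 1 by (elim disjE) linarith+
      next
        case 2
        show ?thesis
          using H[unfolded 2] pos[unfolded 2] B nonneg sym r_pos
          unfolding D unfolding 2 by (elim disjE) linarith+
      qed
    next
      case False
      then have e: "{a, b} \<in> E" and D: "D {a, b} = d {a, b}" using ab by auto
      note ck = edge_diff_le_d_check[OF pm e]
      \<comment> \<open>The last two bounds treat two crossings in opposite senses, where
        \<open>c x y\<close> and \<open>c y x\<close> lie below \<open>r\<close>. Two crossings that
        leave \<open>a\<close> and reach \<open>b\<close> through the same endpoint are settled by
        the triangle inequality below. In all these cases the difference is negative.\<close>
      have "d {a, b} - h a u - h v b \<le> c u v" "d {a, b} - h a x - h v b \<le> c x v"
        "d {a, b} - h a y - h v b \<le> c y v" "d {a, b} - h a u - h x b \<le> c u x"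
        "d {a, b} - h a u - h y b \<le> c u y" "d {a, b} - h a x - h y b \<le> c x y"
        "d {a, b} - h a y - h x b \<le> c y x"
        using ck[OF u v] ck[OF x v] ck[OF y v] ck[OF u x] ck[OF u y] ck[OF x y] ck[OF y x]
        by simp_all
      moreover have "d {a, b} \<le> h a x + h x b" "d {a, b} \<le> h a y + h y b"
        using tri[OF V(1) x V(2)] tri[OF V(1) y V(2)] d_hat_edge[OF pm e] by simp_all
      ultimately show ?thesis
        using H B nonneg sym r_pos check_r check_r' unfolding D by (elim disjE) linarith+
    qed
  qed (use B in auto)
  also have "B < H u v"
  proof -
    have cuv: "c u v < h u v" "0 < h u v"
      using fl u v uv floppy_d_hat_pos[OF gm fl u v] by (auto simp: floppy_def)
    have "u \<noteq> x \<or> v \<noteq> y" "u \<noteq> y \<or> v \<noteq> x"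
      using uv(2) by auto
    \<comment> \<open>This gives the strictness in
      \<open>r - h x u - h y v < h x u + r + h y v\<close> and its mirror image.\<close>
    then have "0 < h x u \<or> 0 < h y v" "0 < h y u \<or> 0 < h x v"
      using floppy_d_hat_pos[OF gm fl] u v x y by metis+
    then have pos: "0 < h x u + h y v" "0 < h y u + h x v"
      using nonneg by linarith+
    \<comment> \<open>Every \<open>c\<close> term is compared with \<open>c x y\<close> or
      \<open>c y x\<close>, both below \<open>r\<close>.\<close>
    have lips: "c u v \<le> c x y + h x u + h y v" "c u v \<le> c y x + h y u + h x v"
      "c x v \<le> c x y + h y v" "c y v \<le> c y x + h x v" "c u x \<le> c y x + h y u"
      "c u y \<le> c x y + h x u"
      using lip[OF u v x y] lip[OF u v y x] lip[OF x v x y] lip[OF y v y x] lip[OF u x y x]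
        lip[OF u y x y] d_hat_refl[OF pm x] d_hat_refl[OF pm y] sym by simp_all
    have chs: "c x v \<le> h x v" "c y v \<le> h y v" "c u x \<le> h x u" "c u y \<le> h y u"
      using ch[OF x v] ch[OF y v] ch[OF u x] ch[OF u y] sym by simp_all
    have tris: "h y v \<le> h y u + h u v" "h x v \<le> h x u + h u v" "h x u \<le> h x v + h u v"
      "h y u \<le> h y v + h u v"
      using tri[OF y u v] tri[OF x u v] tri[OF x v u] tri[OF y v u] sym(5) by simp_all
    \<comment> \<open>Together with \<open>r < h x y\<close>, these keep the new edge's own terms
      below \<open>h u v\<close>.\<close>
    have detours: "h x y \<le> h x u + h u v + h y v" "h x y \<le> h y u + h u v + h x v"
      using tri[OF x u y] tri[OF u v y] tri[OF x v y] tri[OF v u y] unfolding sym by linarith+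
    have less: "B < t" if "0 < t" "c u v < t" "c x v - r - h y u < t" "c y v - r - h x u < t"
      "c u x - r - h y v < t" "c u y - r - h x v < t" "r - h x u - h y v < t"
      "r - h y u - h x v < t" for t
      unfolding B_def by (subst Max_less_iff) (simp_all only: that finite.intros insert_not_empty
        not_False_eq_True ball_simps simp_thms)
    show ?thesis
      using d_hat_insert_cases[OF u v, unfolded sym(1,2)]
    proof (elim disjE)
      assume H: "h u v \<le> H u v"
      show ?thesis
      proof (rule less)
        show "0 < H u v" using H cuv by linarith
        show "c u v < H u v" using H cuv by linarith
        show "c x v - r - h y u < H u v" using H check_r lips(3) tris(1) by linarith
        show "c y v - r - h x u < H u v" using H check_r' lips(4) tris(2) by linarith
        show "c u x - r - h y v < H u v" using H check_r' lips(5) tris(4) by linarith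
        show "c u y - r - h x v < H u v" using H check_r lips(6) tris(3) by linarith
        show "r - h x u - h y v < H u v" using H r_hat detours(1) by linarith
        show "r - h y u - h x v < H u v" using H r_hat detours(2) by linarith
      qed
    next
      assume H: "h x u + r + h y v \<le> H u v"
      show ?thesis
      proof (rule less)
        show "0 < H u v" using H nonneg r_pos by linarith
        show "c u v < H u v" using H check_r lips(1) by linarith
        show "c x v - r - h y u < H u v" using H check_r lips(3) nonneg r_pos by linarith
        show "c y v - r - h x u < H u v" using H chs(2) nonneg r_pos by linarith
        show "c u x - r - h y v < H u v" using H chs(3) nonneg r_pos by linarith
        show "c u y - r - h x v < H u v" using H check_r lips(6) nonneg r_pos by linarith
        show "r - h x u - h y v < H u v" using H pos(1) by linarith
        show "r - h y u - h x v < H u v" using H nonneg pos by linarith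
      qed
    next
      assume H: "h y u + r + h x v \<le> H u v"
      show ?thesis
      proof (rule less)
        show "0 < H u v" using H nonneg r_pos by linarith
        show "c u v < H u v" using H check_r' lips(2) by linarith
        show "c x v - r - h y u < H u v" using H chs(1) nonneg r_pos by linarith
        show "c y v - r - h x u < H u v" using H check_r' lips(4) nonneg r_pos by linarith
        show "c u x - r - h y v < H u v" using H check_r' lips(5) nonneg r_pos by linarith
        show "c u y - r - h x v < H u v" using H chs(4) nonneg r_pos by linarith
        show "r - h x u - h y v < H u v" using H nonneg pos by linarith
        show "r - h y u - h x v < H u v" using H pos(2) by linarith
      qed
    qed
  qed
  finally show ?thesis .
qed

lemma floppy_insert: "floppy F D"
  using graph_metric_insert d_check_less_d_hat_insert vertices_insert[OF x y]
  by (simp add: floppy_def graph_metric_def)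

end

theorem theorem1p7:
  fixes E :: "'a set set" and d :: "'a set \<Rightarrow> real" and x y :: 'a and r :: real
  assumes "graph_metric E d" and "floppy E d"
    and "x \<in> vertices E" and "y \<in> vertices E" and "x \<noteq> y" and "{x, y} \<notin> E"
    and "1/3 * d_check E d x y + 2/3 * d_hat E d x y \<le> r"
    and "r < d_hat E d x y"
  shows "graph_metric (insert {x, y} E) (d({x, y} := r)) \<and>
         floppy (insert {x, y} E) (d({x, y} := r))"
proof -
  have "d_check E d x y < d_hat E d x y"
    using assms by (simp add: floppy_def)
  \<comment> \<open>The lower bound on \<open>r\<close> is a convex combination giving positive
    weight to the strictly larger \<open>d_hat\<close>.\<close>
  then have "d_check E d x y < r"
    using assms(7) by linarith
  then show ?thesis
    using graph_metric_insert[OF assms(1-6) _ assms(8)] floppy_insert[OF assms(1-6) _ assms(8)]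
    by simp
qed

end
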